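(* Let $P \in \mathbb{Q}[x,y]$, let $k \in \mathbb{Q}\setminus\mathcal{B}$ be a generic value of $P$, and let $\mathcal{C} = \{(x,y)\in\mathbb{C}^2 : P(x,y)=k\}$. Suppose that $\mathcal{C}$ is irreducible, that $\mathcal{C}\cap\mathbb{Z}^2$ is infinite, and that there is no $\Phi\in\mathrm{Aut}\,\mathbb{Q}^2$ such that $P\circ\Phi(x,y) = \alpha(x^2-ey^2)+\beta$ with $e$ a positive non-square integer, $\alpha\in\mathbb{Q}\setminus\{0\}$ and $\beta\in\mathbb{Q}$. Let $t\mapsto(p(t),q(t))$, with $p,q\in\mathbb{Q}[t]$, be a polynomial parametrisation of $\mathcal{C}$ with $d := \deg P = \max(\deg p,\deg q) = \deg p$, and write $$p(t) = \frac{1}{b}\left(a_d t^d + a_{d-1}t^{d-1}+\cdots+a_0\right),$$ where $a_0,\ldots,a_d,b\in\mathbb{Z}$, $\gcd(a_0,\ldots,a_d,b)=1$, $a_d>0$, $b>0$. Then for every $\epsilon>0$ there exists $B_0\geq 0$ such that for all $B\geq B_0$, $$N(\mathcal{C},B) \leq 2\,a_d^{1-\frac1d}\, b^{\frac1d}\, B^{\frac1d} + 1 + \epsilon.$$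
   Context: For $P\in\mathbb{Q}[x,y]$, viewed as a map $P:\mathbb{C}^2\to\mathbb{C}$, there is a finite set $\mathcal{B}\subset\mathbb{C}$, taken to be the smallest one, such that $P : P^{-1}(\mathbb{C}\setminus\mathcal{B}) \to \mathbb{C}\setminus\mathcal{B}$ is a topological locally trivial fibration. A value $k\notin\mathcal{B}$ is called a generic value of $P$. An algebraic automorphism $\Phi\in\mathrm{Aut}\,\mathbb{Q}^2$ is a polynomial map $\Phi:\mathbb{Q}^2\to\mathbb{Q}^2$ with rational coefficients that is invertible with inverse also a polynomial map with rational coefficients. A parametrisation of $\mathcal{C}$ means a birational map onto $\mathcal{C}$. For a curve $\mathcal{C}\subset\mathbb{C}^2$ and $B>0$, $$N(\mathcal{C},B) = \#\{(x,y)\in\mathcal{C}\cap\mathbb{Z}^2 : |x|\leq B \text{ and } |y|\leq B\}.$$ *)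

theory Defs
  imports
    "HOL-Analysis.Analysis"
    "HOL-Computational_Algebra.Computational_Algebra"
begin

section \<open>Polynomials in two variables\<close>

text \<open>
  A polynomial in \<open>x, y\<close> over \<open>'a\<close> is an element of \<open>'a poly poly\<close>: the inner variable is \<open>x\<close>
  and the outer one is \<open>y\<close>.
\<close>

definition eval2 :: "'a::comm_ring_1 poly poly \<Rightarrow> 'a \<times> 'a \<Rightarrow> 'a" where
  "eval2 P = (\<lambda>(x, y). poly (poly P [:y:]) x)"

lemma eval2_eq_sum:
  "eval2 P (x, y) = (\<Sum>j\<le>degree P. \<Sum>i\<le>degree (coeff P j). coeff (coeff P j) i * x ^ i * y ^ j)"
proof -
  have "poly (poly P [:y:]) x = (\<Sum>j\<le>degree P. poly (coeff P j) x * y ^ j)"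
    by (simp only: poly_altdef [of P] poly_sum poly_mult poly_power) simp
  then show ?thesis
    by (simp add: eval2_def poly_altdef [of _ x] sum_distrib_right)
qed

definition complexify2 :: "rat poly poly \<Rightarrow> complex poly poly" where
  "complexify2 = map_poly (map_poly of_rat)"

definition total_degree :: "'a::zero poly poly \<Rightarrow> nat" where
  "total_degree P =
     (if P = 0 then 0 else Max {i + j | i j. coeff (coeff P j) i \<noteq> 0})"

lemma finite_total_degree_set: "finite {i + j | i j. coeff (coeff P j) i \<noteq> 0}"
proof (rule finite_subset)
  show "{i + j | i j. coeff (coeff P j) i \<noteq> 0}
      \<subseteq> (\<lambda>(i, j). i + j) ` (SIGMA i:(\<Union>j\<le>degree P. {..degree (coeff P j)}). {..degree P})"
    by (force intro: le_degree simp: image_iff)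
qed auto

definition level_curve :: "rat poly poly \<Rightarrow> rat \<Rightarrow> (complex \<times> complex) set" where
  "level_curve P k = {z. eval2 (complexify2 P) z = of_rat k}"


section \<open>Locally trivial fibrations and generic values\<close>

text \<open>
  Over a trivialising open set \<open>U\<close> containing \<open>c\<close>, the model fibre \<open>F\<close> is homeomorphic to
  \<open>f -` {c}\<close>, so nothing is lost by taking it to be a subspace of the total space.
\<close>

definition locally_trivial_fibration ::
    "('a::topological_space \<Rightarrow> 'b::topological_space) \<Rightarrow> 'b set \<Rightarrow> bool" where
  "locally_trivial_fibration f T \<longleftrightarrow>
     (\<forall>c\<in>T. \<exists>U (F :: 'a set) h g.
        openin (top_of_set T) U \<and> c \<in> U \<and>
        homeomorphism (f -` U) (U \<times> F) h g \<and>
        (\<forall>z\<in>f -` U. fst (h z) = f z))"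

definition fibration_off :: "rat poly poly \<Rightarrow> complex set \<Rightarrow> bool" where
  "fibration_off P S \<longleftrightarrow>
     finite S \<and> locally_trivial_fibration (eval2 (complexify2 P)) (- S)"

text \<open>
  The smallest finite set off which \<open>P\<close> is a locally trivial fibration, written as the
  intersection of all such sets. The lemmas below show that it is itself such a set, hence the
  least one, as soon as there is any.
\<close>

definition bifurcation_set :: "rat poly poly \<Rightarrow> complex set" where
  "bifurcation_set P = \<Inter> {S. fibration_off P S}"

lemma bifurcation_set_le: "fibration_off P S \<Longrightarrow> bifurcation_set P \<subseteq> S"
  by (auto simp: bifurcation_set_def)

lemma fibration_off_bifurcation_set:
  assumes "fibration_off P S"
  shows "fibration_off P (bifurcation_set P)"
proof -
  have "finite (bifurcation_set P)"
    using assms bifurcation_set_le finite_subset unfolding fibration_off_def by metis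
  moreover have "locally_trivial_fibration (eval2 (complexify2 P)) (- bifurcation_set P)"
    unfolding locally_trivial_fibration_def
  proof
    let ?f = "eval2 (complexify2 P)"
    fix c assume "c \<in> - bifurcation_set P"
    then obtain S' where S': "fibration_off P S'" "c \<in> - S'"
      by (auto simp: bifurcation_set_def)
    then obtain U h g and F :: "(complex \<times> complex) set"
      where U: "openin (top_of_set (- S')) U" "c \<in> U"
        "homeomorphism (?f -` U) (U \<times> F) h g" "\<forall>z\<in>?f -` U. fst (h z) = ?f z"
      unfolding fibration_off_def locally_trivial_fibration_def by meson
    have "open (- S')"
      using S'(1) by (auto simp: fibration_off_def open_Compl finite_imp_closed)
    then have "open U" "U \<subseteq> - S'"
      using U(1) by (auto simp: openin_open_eq)
    moreover have "- S' \<subseteq> - bifurcation_set P"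
      using bifurcation_set_le[OF S'(1)] by auto
    ultimately have "openin (top_of_set (- bifurcation_set P)) U"
      by (meson open_subset order_trans)
    with U(2-) show "\<exists>U (F :: (complex \<times> complex) set) h g.
        openin (top_of_set (- bifurcation_set P)) U \<and> c \<in> U \<and>
        homeomorphism (?f -` U) (U \<times> F) h g \<and> (\<forall>z\<in>?f -` U. fst (h z) = ?f z)"
      by blast
  qed
  ultimately show ?thesis by (simp add: fibration_off_def)
qed

lemma bifurcation_set_eq_Least:
  "fibration_off P S \<Longrightarrow> bifurcation_set P = (LEAST S. fibration_off P S)"
  by (rule Least_equality [symmetric])
     (auto intro: fibration_off_bifurcation_set dest: bifurcation_set_le)


section \<open>Plane curves\<close>

definition algebraic_set :: "('a::comm_ring_1 \<times> 'a) set \<Rightarrow> bool" where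
  "algebraic_set X \<longleftrightarrow> (\<exists>I. X = {z. \<forall>f\<in>I. eval2 f z = 0})"

definition irreducible_algebraic_set :: "('a::comm_ring_1 \<times> 'a) set \<Rightarrow> bool" where
  "irreducible_algebraic_set X \<longleftrightarrow>
     algebraic_set X \<and> X \<noteq> {} \<and>
     (\<forall>Y Z. algebraic_set Y \<longrightarrow> algebraic_set Z \<longrightarrow> X = Y \<union> Z \<longrightarrow> X = Y \<or> X = Z)"

text \<open>
  A polynomial map from the affine line that is birational onto \<open>C\<close>. The rational inverse is
  \<open>U / V\<close>, where \<open>V\<close> does not vanish identically on \<open>C\<close>; when \<open>C\<close> is irreducible it is thus
  defined on a dense open subset of \<open>C\<close>, and the two maps are inverse to each other wherever
  the compositions are defined.
\<close>

definition polynomial_parametrisation ::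
    "(complex \<times> complex) set \<Rightarrow> complex poly \<Rightarrow> complex poly \<Rightarrow> bool" where
  "polynomial_parametrisation C p q \<longleftrightarrow>
     range (\<lambda>t. (poly p t, poly q t)) = C \<and>
     (\<exists>U V.
        (\<exists>z\<in>C. eval2 V z \<noteq> 0) \<and>
        (\<forall>t. eval2 V (poly p t, poly q t) \<noteq> 0 \<longrightarrow>
             eval2 U (poly p t, poly q t) / eval2 V (poly p t, poly q t) = t) \<and>
        (\<forall>z\<in>C. eval2 V z \<noteq> 0 \<longrightarrow>
             (poly p (eval2 U z / eval2 V z), poly q (eval2 U z / eval2 V z)) = z))"

definition integral_points :: "(complex \<times> complex) set \<Rightarrow> (complex \<times> complex) set" where
  "integral_points C = C \<inter> (\<int> \<times> \<int>)"

definition num_integral_points :: "(complex \<times> complex) set \<Rightarrow> real \<Rightarrow> nat" where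
  "num_integral_points C B = card {(x, y) \<in> integral_points C. norm x \<le> B \<and> norm y \<le> B}"


section \<open>Algebraic automorphisms of the plane\<close>

definition polynomial_map :: "('a::comm_ring_1 \<times> 'a \<Rightarrow> 'a \<times> 'a) \<Rightarrow> bool" where
  "polynomial_map \<Phi> \<longleftrightarrow> (\<exists>f g. \<forall>z. \<Phi> z = (eval2 f z, eval2 g z))"

definition plane_automorphism :: "('a::comm_ring_1 \<times> 'a \<Rightarrow> 'a \<times> 'a) \<Rightarrow> bool" where
  "plane_automorphism \<Phi> \<longleftrightarrow> polynomial_map \<Phi> \<and> bij \<Phi> \<and> polynomial_map (inv \<Phi>)"

end

theory Submission
  imports Defs
begin

text \<open>
  Let \<open>\<gamma> = (p, q)\<close>. Birationality makes \<open>\<gamma>\<close> injective off a finite set, and genericity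
  of \<open>k\<close> removes the exceptions: if two branches \<open>\<gamma>(D0)\<close> and \<open>\<gamma>(D1)\<close> met in a point, the local
  trivialisation \<open>P\<^sup>-\<^sup>1(U) \<cong> U \<times> F\<close> and invariance of domain would make \<open>U \<times> \<gamma>(D1)\<close> open in the
  plane, so points of \<open>\<gamma>(D0)\<close> near the crossing would also lie on \<open>\<gamma>(D1)\<close>. As conjugate
  parameters have the same image when that image is rational, each integral point has a rational
  parameter \<open>t\<close>, and \<open>p(t) \<in> \<int>\<close> forces \<open>a\<^sub>d t \<in> \<int>\<close>. The bound then counts the
  integers \<open>a\<^sub>d t\<close> with \<open>\<bar>p(t)\<bar> \<le> B\<close>, which fill an interval of half-length
  \<open>a\<^sub>d (b B / a\<^sub>d)\<^bsup>1/d\<^esup> + o(1)\<close>.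
\<close>

section \<open>Injectivity of the parametrisation of a generic fibre\<close>

text \<open>Invariance of domain applies because base times parameter space has the same dimension
  as the total space. The set \<open>E\<close> collects the parameters at which injectivity is not
  known beforehand.\<close>

lemma inj_if_locally_trivial_fibration:
  fixes f :: "'a::euclidean_space \<times> 'a \<Rightarrow> 'a" and \<gamma> :: "'a \<Rightarrow> 'a \<times> 'a"
  assumes fib: "locally_trivial_fibration f T" and "open T" "k \<in> T"
    and cont: "continuous_on UNIV \<gamma>" and fibre: "\<And>t. f (\<gamma> t) = k"
    and "finite E" and inj_off: "\<And>s t. \<gamma> s = \<gamma> t \<Longrightarrow> s \<notin> E \<Longrightarrow> s = t"
  shows "inj \<gamma>"
proof (rule injI, rule ccontr)
  fix t0 t1 assume eq: "\<gamma> t0 = \<gamma> t1" and "t0 \<noteq> t1"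
  obtain U h g and F :: "('a \<times> 'a) set"
    where U: "openin (top_of_set T) U" "k \<in> U"
      and hom: "homeomorphism (f -` U) (U \<times> F) h g"
      and fst_h: "\<And>z. z \<in> f -` U \<Longrightarrow> fst (h z) = f z"
    using fib \<open>k \<in> T\<close> unfolding locally_trivial_fibration_def by meson
  have "open U" using U(1) \<open>open T\<close> by (simp add: openin_open_eq)
  have \<gamma>_in: "\<gamma> t \<in> f -` U" for t using fibre U(2) by simp
  \<comment> \<open>The fibre coordinate of \<open>\<gamma> t\<close>. It determines
    \<open>\<gamma> t\<close>, as the base coordinate is always \<open>k\<close>.\<close>
  define \<sigma> where "\<sigma> t = snd (h (\<gamma> t))" for t
  have h_\<gamma>: "h (\<gamma> t) = (k, \<sigma> t)" for t
    using fst_h[OF \<gamma>_in[of t]] fibre[of t] by (simp add: prod_eq_iff \<sigma>_def)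
  have \<sigma>_in: "\<sigma> t \<in> F" for t
    using imageI[OF \<gamma>_in[of t], of h] unfolding homeomorphism_image1[OF hom] h_\<gamma> by blast
  have g_\<sigma>: "g (k, \<sigma> t) = \<gamma> t" for t
    using homeomorphism_apply1[OF hom \<gamma>_in[of t]] unfolding h_\<gamma> .
  have \<gamma>_eq: "\<gamma> s = \<gamma> t" if "\<sigma> s = \<sigma> t" for s t
    using g_\<sigma>[of s] g_\<sigma>[of t] that by simp
  \<comment> \<open>The trivialisation transports the curve to the nearby fibres:
    \<open>\<Phi> (c, t)\<close> lies over \<open>c\<close> and has the fibre coordinate of
    \<open>\<gamma> t\<close>, so \<open>\<Phi> (k, t) = \<gamma> t\<close>.\<close>
  define \<Phi> where "\<Phi> = (\<lambda>(c, t). g (c, \<sigma> t))"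
  have h_\<Phi>: "h (\<Phi> (c, t)) = (c, \<sigma> t)" if "c \<in> U" for c t
    using homeomorphism_apply2[OF hom, of "(c, \<sigma> t)"] that \<sigma>_in[of t] by (simp add: \<Phi>_def)
  obtain D0 D1 where D: "open D0" "open D1" "t0 \<in> D0" "t1 \<in> D1" "D0 \<inter> D1 = {}"
    using hausdorff[OF \<open>t0 \<noteq> t1\<close>] by blast
  \<comment> \<open>At most one parameter of \<open>A\<close> is in \<open>E\<close>, namely
    \<open>t1\<close>; of two distinct parameters in \<open>A\<close> one is therefore outside
    \<open>E\<close>, so \<open>\<gamma>\<close> is injective on \<open>A\<close>.\<close>
  define A where "A = D1 - (E - {t1})"
  have "open A" unfolding A_def using D(2) \<open>finite E\<close>
    by (intro open_Diff finite_imp_closed) auto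
  have "t1 \<in> A" using D by (simp add: A_def)
  have inj_A: "s = t" if "s \<in> A" "t \<in> A" "\<gamma> s = \<gamma> t" for s t
  proof (cases "s \<in> E \<and> t \<in> E")
    case True
    then show ?thesis using that(1,2) by (auto simp: A_def)
  next
    case False
    then show ?thesis using that(3) inj_off by metis
  qed
  have "open (\<Phi> ` (U \<times> A))"
  proof (rule invariance_of_domain)
    show "open (U \<times> A)" using \<open>open U\<close> \<open>open A\<close> by (rule open_Times)
    have cont_h: "continuous_on (f -` U) h" and cont_g: "continuous_on (U \<times> F) g"
      using homeomorphism_cont1[OF hom] homeomorphism_cont2[OF hom] .
    have "continuous_on (U \<times> A) (\<lambda>x. \<gamma> (snd x))"
      by (rule continuous_on_compose2[OF cont continuous_on_snd[OF continuous_on_id]]) simp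
    then have "continuous_on (U \<times> A) (\<lambda>x. h (\<gamma> (snd x)))"
      by (rule continuous_on_compose2[OF cont_h]) (use \<gamma>_in in blast)
    then have "continuous_on (U \<times> A) (\<lambda>x. (fst x, \<sigma> (snd x)))"
      unfolding \<sigma>_def
      by (intro continuous_on_Pair continuous_on_fst continuous_on_snd continuous_on_id)
    then show "continuous_on (U \<times> A) \<Phi>"
      unfolding \<Phi>_def case_prod_unfold
      by (rule continuous_on_compose2[OF cont_g]) (use \<sigma>_in in auto)
    show "inj_on \<Phi> (U \<times> A)"
    proof (rule inj_onI)
      fix x y assume x: "x \<in> U \<times> A" and y: "y \<in> U \<times> A" and "\<Phi> x = \<Phi> y"
      have in_UA: "fst x \<in> U" "snd x \<in> A" "fst y \<in> U" "snd y \<in> A" using x y by auto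
      have "(fst x, \<sigma> (snd x)) = (fst y, \<sigma> (snd y))"
        using h_\<Phi>[OF in_UA(1), of "snd x"] h_\<Phi>[OF in_UA(3), of "snd y"] \<open>\<Phi> x = \<Phi> y\<close> by simp
      then have "fst x = fst y" "\<gamma> (snd x) = \<gamma> (snd y)" by (auto intro: \<gamma>_eq)
      then show "x = y" using inj_A[OF in_UA(2,4)] by (simp add: prod_eq_iff)
    qed
  qed
  then have "open (\<gamma> -` (\<Phi> ` (U \<times> A)))"
    using cont by (simp add: continuous_on_open_vimage)
  then have "open (D0 \<inter> \<gamma> -` (\<Phi> ` (U \<times> A)))" (is "open ?N") using D(1) by blast
  moreover have "\<gamma> t1 = \<Phi> (k, t1)" using g_\<sigma>[of t1] by (simp add: \<Phi>_def)
  then have "t0 \<in> ?N" using D(3) eq \<open>t1 \<in> A\<close> U(2) by auto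
  \<comment> \<open>The point \<open>t0\<close> must itself lie in \<open>E\<close>, since otherwise
    \<open>t0 = t1\<close>. Another parameter of \<open>?N\<close>, outside \<open>E\<close>, is
    needed; it exists because a nonempty open set is infinite.\<close>
  ultimately have "infinite ?N"
    using not_open_singleton finite_imp_not_open by (metis empty_iff)
  then obtain s where s: "s \<in> ?N" "s \<notin> E"
    using \<open>finite E\<close> by (meson finite_subset subsetI)
  then obtain c t where ct: "c \<in> U" "t \<in> A" "\<gamma> s = \<Phi> (c, t)" by auto
  \<comment> \<open>Applying \<open>h\<close> to both sides of
    \<open>\<gamma> s = \<Phi> (c, t)\<close> compares fibre coordinates. The resulting
    \<open>s = t\<close> contradicts \<open>D0 \<inter> D1 = {}\<close>.\<close>
  then have "\<sigma> s = \<sigma> t" using h_\<Phi>[of c t] h_\<gamma>[of s] by simp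
  then have "s = t" by (rule inj_off[OF \<gamma>_eq s(2)])
  then show False using s(1) ct(2) D(5) by (auto simp: A_def)
qed

lemma poly_composition_eval2: "\<exists>R. \<forall>t. poly R t = eval2 V (poly p t, poly q t)"
proof (induction V)
  case 0
  show ?case by (intro exI[of _ 0]) (simp add: eval2_def)
next
  case (pCons a V)
  from pCons.IH obtain R where "\<forall>t. poly R t = eval2 V (poly p t, poly q t)" ..
  then show ?case
    by (intro exI[of _ "pcompose a p + q * R"]) (simp add: eval2_def poly_pcompose)
qed

text \<open>The rational inverse \<open>U / V\<close> recovers the parameter wherever
  \<open>V\<close> does not vanish, so the exceptional parameters are among the roots of
  \<open>V\<close> pulled back along the curve. These are finitely many, as \<open>V\<close> is
  nonzero somewhere on the curve.\<close>

lemma inj_polynomial_parametrisation: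
  assumes generic: "of_rat k \<notin> bifurcation_set P"
    and param: "polynomial_parametrisation (level_curve P k) p q"
  shows "inj (\<lambda>t. (poly p t, poly q t))"
proof -
  \<comment> \<open>A value outside an intersection is outside one of its members, which also shows
    that such an \<open>S\<close> exists.\<close>
  obtain S where S: "fibration_off P S" "of_rat k \<notin> S"
    using generic by (auto simp: bifurcation_set_def)
  from param obtain U V where range: "range (\<lambda>t. (poly p t, poly q t)) = level_curve P k"
    and V: "\<exists>z\<in>level_curve P k. eval2 V z \<noteq> 0"
    and inv: "\<forall>t. eval2 V (poly p t, poly q t) \<noteq> 0 \<longrightarrow>
             eval2 U (poly p t, poly q t) / eval2 V (poly p t, poly q t) = t"
    unfolding polynomial_parametrisation_def by (elim conjE exE)
  obtain R where R: "\<And>t. poly R t = eval2 V (poly p t, poly q t)"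
    using poly_composition_eval2[of V p q] by metis
  have "R \<noteq> 0"
  proof
    assume "R = 0"
    then have "eval2 V (poly p t, poly q t) = 0" for t using R[of t] by simp
    then show False using V by (auto simp flip: range)
  qed
  show ?thesis
  proof (rule inj_if_locally_trivial_fibration[where f = "eval2 (complexify2 P)" and T = "- S"
        and k = "of_rat k" and E = "{t. poly R t = 0}"])
    show "locally_trivial_fibration (eval2 (complexify2 P)) (- S)" "open (- S)" "of_rat k \<in> - S"
      using S by (auto simp: fibration_off_def finite_imp_closed open_Compl)
    show "continuous_on UNIV (\<lambda>t. (poly p t, poly q t))" by (intro continuous_intros)
    show "eval2 (complexify2 P) (poly p t, poly q t) = of_rat k" for t
      using range by (auto simp: level_curve_def)
    show "finite {t. poly R t = 0}" using \<open>R \<noteq> 0\<close> by (rule poly_roots_finite)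
    show "s = t" if eq: "(poly p s, poly q s) = (poly p t, poly q t)" and "s \<notin> {t. poly R t = 0}" for s t
    proof -
      have "eval2 V (poly p s, poly q s) \<noteq> 0" using that(2) R[of s] by simp
      then show ?thesis using inv eq by metis
    qed
  qed
qed

section \<open>Rationality of a unique common root\<close>

lemma map_poly_of_rat_mult:
  "map_poly (of_rat :: rat \<Rightarrow> 'a::field_char_0) (p * q) = map_poly of_rat p * map_poly of_rat q"
  by (rule poly_eqI) (simp add: coeff_map_poly coeff_mult of_rat_sum of_rat_mult)

lemma map_poly_of_rat_add:
  "map_poly (of_rat :: rat \<Rightarrow> 'a::field_char_0) (p + q) = map_poly of_rat p + map_poly of_rat q"
  by (rule poly_eqI) (simp add: coeff_map_poly of_rat_add)

lemma degree_map_poly_of_rat: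
  "degree (map_poly (of_rat :: rat \<Rightarrow> 'a::field_char_0) p) = degree p"
  by (rule degree_map_poly) simp

lemma pderiv_map_poly_of_rat:
  "pderiv (map_poly (of_rat :: rat \<Rightarrow> 'a::field_char_0) p) = map_poly of_rat (pderiv p)"
  by (rule poly_eqI) (simp add: coeff_map_poly coeff_pderiv of_rat_mult of_rat_add)

lemma poly_map_poly_of_rat:
  "poly (map_poly (of_rat :: rat \<Rightarrow> 'a::field_char_0) p) (of_rat t) = of_rat (poly p t)"
  by (simp add: poly_altdef degree_map_poly_of_rat coeff_map_poly of_rat_sum of_rat_mult of_rat_power)

text \<open>A minimal polynomial over the rationals divides both polynomials, so it has no other root;
  as its roots are simple, it is linear.\<close>

lemma rational_if_unique_common_root:
  fixes p q :: "rat poly" and z :: complex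
  assumes "p \<noteq> 0" and pz: "poly (map_poly of_rat p) z = 0" and qz: "poly (map_poly of_rat q) z = 0"
    and unique: "\<And>w. poly (map_poly of_rat p) w = 0 \<Longrightarrow> poly (map_poly of_rat q) w = 0 \<Longrightarrow> w = z"
  shows "z \<in> \<rat>"
proof -
  let ?c = "map_poly (of_rat :: rat \<Rightarrow> complex)"
  \<comment> \<open>\<open>G\<close> is the minimal polynomial of \<open>z\<close> up to a constant
    factor.\<close>
  obtain G where G: "G \<noteq> 0" "poly (?c G) z = 0"
    and least: "\<And>f. f \<noteq> 0 \<and> poly (?c f) z = 0 \<Longrightarrow> degree G \<le> degree f"
    using ex_has_least_nat[of "\<lambda>f. f \<noteq> 0 \<and> poly (?c f) z = 0" p degree] \<open>p \<noteq> 0\<close> pz by blast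
  have dvd: "G dvd f" if "poly (?c f) z = 0" for f
  proof (rule ccontr)
    assume "\<not> G dvd f"
    then have "f mod G \<noteq> 0" by (simp add: dvd_eq_mod_eq_0)
    have "?c f = ?c (f div G) * ?c G + ?c (f mod G)"
      by (simp flip: map_poly_of_rat_mult map_poly_of_rat_add)
    then have "poly (?c (f mod G)) z = 0" using that G(2) by simp
    then show False
      using least[of "f mod G"] \<open>f mod G \<noteq> 0\<close> degree_mod_less[OF G(1), of f] by auto
  qed
  have root: "w = z" if "poly (?c G) w = 0" for w
    using dvd[OF pz] dvd[OF qz] that unique[of w]
    by (auto simp: map_poly_of_rat_mult elim!: dvdE)
  have "degree G \<noteq> 0"
  proof
    assume "degree G = 0"
    then obtain c where "G = [:c:]" by (metis degree_eq_zeroE)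
    then show False using G by (simp add: map_poly_pCons)
  qed
  \<comment> \<open>In characteristic 0 the derivative is nonzero of smaller degree, so by
    minimality it does not vanish at \<open>z\<close>.\<close>
  then have "pderiv G \<noteq> 0" by (simp add: pderiv_eq_0_iff)
  then have simple: "poly (pderiv (?c G)) z \<noteq> 0"
    using least[of "pderiv G"] \<open>degree G \<noteq> 0\<close> by (auto simp: pderiv_map_poly_of_rat degree_pderiv)
  obtain H where H: "?c G = [:- z, 1:] * H"
    using G(2) by (metis poly_eq_0_iff_dvd dvdE)
  have "poly H z \<noteq> 0" using simple by (simp add: H pderiv_mult pderiv_pCons del: mult_pCons_left)
  \<comment> \<open>A root of \<open>H\<close> is a root of \<open>G\<close>, hence equals
    \<open>z\<close>, which is excluded; so \<open>H\<close> is constant.\<close>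
  then have "poly H w \<noteq> 0" for w using root[of w] by (auto simp: H)
  then have "degree H = 0"
    using fundamental_theorem_of_algebra[of H] by (auto simp: constant_degree)
  moreover have "H \<noteq> 0" using \<open>poly H z \<noteq> 0\<close> by auto
  ultimately have "degree G = 1"
    using arg_cong[OF H, of degree] by (simp add: degree_mult_eq degree_map_poly_of_rat del: mult_pCons_left)
  then have "coeff G 1 \<noteq> 0" by (metis leading_coeff_0_iff G(1))
  have "poly (?c G) z = of_rat (coeff G 0) + of_rat (coeff G 1) * z"
    using \<open>degree G = 1\<close> by (simp add: poly_altdef degree_map_poly_of_rat coeff_map_poly)
  then have "z = of_rat (- coeff G 0 / coeff G 1)"
    using G(2) \<open>coeff G 1 \<noteq> 0\<close> by (simp add: of_rat_divide of_rat_minus field_simps add_eq_0_iff)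
  then show ?thesis by (metis Rats_of_rat)
qed

section \<open>Denominators of rational parameters\<close>

text \<open>As in the rational root theorem: write \<open>t = u / v\<close> in lowest terms and
  multiply by \<open>v ^ d\<close>. Every term except \<open>a d * u ^ d\<close> is then divisible
  by \<open>v\<close>, so \<open>v\<close> divides \<open>a d\<close>.\<close>

lemma lead_coeff_mult_root_in_Ints:
  fixes a :: "nat \<Rightarrow> int" and t :: rat
  assumes "d > 0" and eq: "(\<Sum>i\<le>d. of_int (a i) * t ^ i) = of_int c"
  shows "of_int (a d) * t \<in> \<int>"
proof -
  obtain u v where uv: "quotient_of t = (u, v)" by (cases "quotient_of t")
  have "v > 0" "coprime u v" and t: "t = of_int u / of_int v"
    using uv quotient_of_denom_pos quotient_of_coprime quotient_of_div by blast+
  have "(of_int (\<Sum>i\<le>d. a i * u ^ i * v ^ (d - i)) :: rat)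
      = (\<Sum>i\<le>d. of_int (a i) * t ^ i) * of_int v ^ d"
    unfolding sum_distrib_right of_int_sum
  proof (rule sum.cong[OF refl])
    fix i assume "i \<in> {..d}"
    then have "(of_int v :: rat) ^ d = of_int v ^ i * of_int v ^ (d - i)"
      by (simp flip: power_add)
    then show "of_int (a i * u ^ i * v ^ (d - i)) = of_int (a i) * t ^ i * of_int v ^ d"
      using \<open>v > 0\<close> by (simp add: t power_divide)
  qed
  also have "\<dots> = of_int (c * v ^ d)" by (simp add: eq)
  finally have "(\<Sum>i\<le>d. a i * u ^ i * v ^ (d - i)) = c * v ^ d"
    by (simp only: of_int_eq_iff)
  moreover have "(\<Sum>i\<le>d. a i * u ^ i * v ^ (d - i))
      = (\<Sum>i<d. a i * u ^ i * v ^ (d - i)) + a d * u ^ d"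
    by (simp add: lessThan_Suc_atMost[symmetric])
  moreover have "v dvd (\<Sum>i<d. a i * u ^ i * v ^ (d - i))"
    by (intro dvd_sum dvd_mult) (simp add: dvd_power)
  moreover have "v dvd c * v ^ d" using \<open>d > 0\<close> by (simp add: dvd_power)
  ultimately have "v dvd a d * u ^ d" by (metis dvd_add_right_iff)
  then have "v dvd a d"
    using \<open>coprime u v\<close> by (simp add: coprime_dvd_mult_left_iff coprime_commute)
  then obtain w where "a d = v * w" by blast
  then have "of_int (a d) * t = of_int (w * u)" using \<open>v > 0\<close> by (simp add: t)
  then show ?thesis by (metis Ints_of_int)
qed

section \<open>Sublevel sets of a real polynomial\<close>

text \<open>An estimate of order \<open>n - 1\<close> for \<open>R\<close>. The factor
  \<open>\<bar>w\<bar>\<close> on the left replaces that exponent, so that \<open>n = 0\<close>,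
  where \<open>R = 0\<close>, is covered.\<close>

lemma poly_mult_abs_le:
  fixes R :: "real poly"
  assumes "\<And>i. coeff R i \<noteq> 0 \<Longrightarrow> i < n"
  obtains K where "\<And>w. \<bar>w\<bar> \<ge> 1 \<Longrightarrow> \<bar>poly R w\<bar> * \<bar>w\<bar> \<le> K * \<bar>w\<bar> ^ n"
proof
  fix w :: real assume "\<bar>w\<bar> \<ge> 1"
  have "\<bar>poly R w\<bar> * \<bar>w\<bar> \<le> (\<Sum>i\<le>degree R. \<bar>coeff R i * w ^ i\<bar>) * \<bar>w\<bar>"
    unfolding poly_altdef by (intro mult_right_mono sum_abs) simp
  also have "\<dots> \<le> (\<Sum>i\<le>degree R. \<bar>coeff R i\<bar>) * \<bar>w\<bar> ^ n"
    unfolding sum_distrib_right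
  proof (rule sum_mono)
    fix i
    show "\<bar>coeff R i * w ^ i\<bar> * \<bar>w\<bar> \<le> \<bar>coeff R i\<bar> * \<bar>w\<bar> ^ n"
    proof (cases "coeff R i = 0")
      case False
      then have "\<bar>w\<bar> ^ Suc i \<le> \<bar>w\<bar> ^ n"
        using assms \<open>\<bar>w\<bar> \<ge> 1\<close> by (intro power_increasing Suc_leI)
      then show ?thesis
        by (simp add: abs_mult power_abs mult.assoc mult_left_mono mult.commute[of "\<bar>w\<bar> ^ i"])
    qed simp
  qed
  finally show "\<bar>poly R w\<bar> * \<bar>w\<bar> \<le> (\<Sum>i\<le>degree R. \<bar>coeff R i\<bar>) * \<bar>w\<bar> ^ n" .
qed

text \<open>After the translation by \<open>\<beta>\<close> the subleading coefficient vanishes, so the radius of the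
  sublevel set is determined up to a term tending to \<open>0\<close>.\<close>

lemma poly_sublevel_radius:
  fixes p :: "real poly" and \<epsilon> :: real
  defines "d \<equiv> degree p" and "L \<equiv> lead_coeff p"
  defines "\<beta> \<equiv> coeff p (d - 1) / (real d * L)"
  assumes "d > 0" "L > 0" "\<epsilon> > 0"
  obtains B0 where "B0 \<ge> 0"
    "\<And>B t. B \<ge> B0 \<Longrightarrow> \<bar>poly p t\<bar> \<le> B \<Longrightarrow> \<bar>t + \<beta>\<bar> \<le> (B / L) powr (1 / real d) + \<epsilon>"
proof -
  define R where "R = smult (1 / L) p - [:\<beta>, 1:] ^ d"
  define R' where "R' = pcompose R [:- \<beta>, 1:]"
  \<comment> \<open>\<open>\<beta>\<close> is chosen so that \<open>d * \<beta>\<close>, the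
    coefficient of \<open>[:\<beta>, 1:] ^ d\<close> at \<open>d - 1\<close>, agrees with that of
    \<open>p / L\<close>.\<close>
  have "coeff R i = 0" if "i \<ge> d - 1" for i
  proof -
    consider "i > d" | "i = d" | "i = d - 1" "i < d" using \<open>i \<ge> d - 1\<close> by linarith
    then show ?thesis
    proof cases
      case 1
      then have "degree ([:\<beta>, 1:] ^ d) < i" by (simp add: degree_linear_power)
      then show ?thesis using 1 by (simp add: R_def coeff_eq_0 d_def)
    next
      case 2
      then have "coeff p i = L" by (simp add: d_def L_def)
      then show ?thesis using 2 \<open>L > 0\<close> by (simp add: R_def coeff_linear_poly_power)
    next
      case 3
      have "d choose (d - 1) = d" using \<open>d > 0\<close> by (cases d) auto
      then show ?thesis using 3 \<open>L > 0\<close> \<open>d > 0\<close>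
        by (simp add: R_def coeff_linear_poly_power \<beta>_def)
    qed
  qed
  then have "R = 0 \<or> degree R < d - 1" by (metis leading_coeff_0_iff not_le)
  then have "i < d - 1" if "coeff R' i \<noteq> 0" for i
    using le_degree[OF that] that by (auto simp: R'_def degree_pcompose)
  then obtain K where K: "\<And>w. \<bar>w\<bar> \<ge> 1 \<Longrightarrow> \<bar>poly R' w\<bar> * \<bar>w\<bar> \<le> K * \<bar>w\<bar> ^ (d - 1)"
    using poly_mult_abs_le[of R'] by blast
  have poly_p: "poly p t = L * ((t + \<beta>) ^ d + poly R' (t + \<beta>))" for t
    using \<open>L > 0\<close> by (simp add: R'_def R_def poly_pcompose add.commute)
  \<comment> \<open>For \<open>W > M\<close> the bound by \<open>K\<close> applies and
    \<open>K < \<epsilon> * W\<close>, which makes the error smaller than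
    \<open>\<epsilon> * W ^ (d - 1)\<close>. The threshold \<open>L * M ^ d\<close> for
    \<open>B\<close> ensures \<open>M \<le> r\<close>.\<close>
  define M where "M = max 1 (K / \<epsilon>)"
  have "M > 0" by (simp add: M_def)
  show thesis
  proof
    show "L * M ^ d \<ge> 0" using \<open>L > 0\<close> \<open>M > 0\<close> by simp
    fix B t assume B: "B \<ge> L * M ^ d" and t: "\<bar>poly p t\<bar> \<le> B"
    define r where "r = (B / L) powr (1 / real d)"
    define W where "W = \<bar>t + \<beta>\<bar>"
    have ge: "B / L \<ge> M ^ d" using B \<open>L > 0\<close> by (simp add: field_simps)
    moreover have "M ^ d > 0" using \<open>M > 0\<close> by simp
    ultimately have "B / L > 0" by linarith
    then have "r > 0" unfolding r_def powr_gt_zero by (rule less_imp_neq[THEN not_sym])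
    have "r ^ d = B / L"
      using \<open>B / L > 0\<close> \<open>d > 0\<close> \<open>r > 0\<close>
      by (simp only: powr_realpow[symmetric]) (simp add: r_def powr_powr abs_of_pos flip: abs_divide)
    have "M \<le> r"
      using ge \<open>r ^ d = B / L\<close> \<open>r > 0\<close> \<open>d > 0\<close> by (metis power_mono_iff less_imp_le \<open>M > 0\<close>)
    show "\<bar>t + \<beta>\<bar> \<le> (B / L) powr (1 / real d) + \<epsilon>"
    proof (rule ccontr)
      assume "\<not> ?thesis"
      then have W: "W > r + \<epsilon>" by (simp add: r_def W_def)
      then have "W > M" "W > 0" "W \<ge> 1" using \<open>M \<le> r\<close> \<open>r > 0\<close> \<open>\<epsilon> > 0\<close> by (auto simp: M_def)
      then have "K < \<epsilon> * W" using \<open>\<epsilon> > 0\<close> by (auto simp: M_def field_simps)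
      have Wd: "W ^ d = W * W ^ (d - 1)" using \<open>d > 0\<close> by (cases d) auto
      have "\<bar>poly R' (t + \<beta>)\<bar> * W \<le> K * W ^ (d - 1)"
        using K[of "t + \<beta>"] \<open>W \<ge> 1\<close> by (simp add: W_def)
      also have "\<dots> < \<epsilon> * W * W ^ (d - 1)"
        using \<open>K < \<epsilon> * W\<close> \<open>W > 0\<close> by (intro mult_strict_right_mono) auto
      finally have R': "\<bar>poly R' (t + \<beta>)\<bar> < \<epsilon> * W ^ (d - 1)"
        using \<open>W > 0\<close> by (simp add: mult.assoc mult.left_commute[of _ W] mult.commute[of _ W])
      \<comment> \<open>Replacing all but one factor \<open>W - \<epsilon>\<close> by
        \<open>W\<close> leaves a gain of \<open>\<epsilon> * W ^ (d - 1)\<close>, which outweighs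
        the error; hence \<open>\<bar>poly p t\<bar> / L > r ^ d = B / L\<close>.\<close>
      have "r ^ d \<le> (W - \<epsilon>) ^ d" using W \<open>r > 0\<close> by (intro power_mono) auto
      also have "\<dots> = (W - \<epsilon>) * (W - \<epsilon>) ^ (d - 1)" using \<open>d > 0\<close> by (cases d) auto
      also have "\<dots> \<le> (W - \<epsilon>) * W ^ (d - 1)"
        using W \<open>r > 0\<close> \<open>\<epsilon> > 0\<close> by (intro mult_left_mono power_mono) auto
      also have "\<dots> = W ^ d - \<epsilon> * W ^ (d - 1)" by (simp add: Wd algebra_simps)
      also have "\<dots> < W ^ d - \<bar>poly R' (t + \<beta>)\<bar>" using R' by simp
      also have "\<dots> \<le> \<bar>(t + \<beta>) ^ d + poly R' (t + \<beta>)\<bar>"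
        unfolding W_def power_abs[symmetric] by linarith
      also have "\<dots> = \<bar>poly p t\<bar> / L" using \<open>L > 0\<close> by (simp add: poly_p abs_mult)
      finally show False using \<open>r ^ d = B / L\<close> t \<open>L > 0\<close> by (simp add: divide_less_cancel)
    qed
  qed
qed

section \<open>Counting integral points\<close>

text \<open>Source of the additive 1 in the final bound; it is attained when both ends of the
  interval are integers.\<close>

lemma card_int_abs_le:
  fixes x \<rho> :: real
  assumes "\<rho> \<ge> 0"
  shows "finite {s::int. \<bar>of_int s + x\<bar> \<le> \<rho>}" "real (card {s::int. \<bar>of_int s + x\<bar> \<le> \<rho>}) \<le> 2 * \<rho> + 1"
proof -
  have eq: "{s::int. \<bar>of_int s + x\<bar> \<le> \<rho>} = {\<lceil>- x - \<rho>\<rceil>..\<lfloor>\<rho> - x\<rfloor>}"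
    by (auto simp: ceiling_le_iff le_floor_iff)
  show "finite {s::int. \<bar>of_int s + x\<bar> \<le> \<rho>}" by (simp add: eq)
  have "real_of_int (\<lfloor>\<rho> - x\<rfloor> - \<lceil>- x - \<rho>\<rceil> + 1) \<le> 2 * \<rho> + 1" by linarith
  then show "real (card {s::int. \<bar>of_int s + x\<bar> \<le> \<rho>}) \<le> 2 * \<rho> + 1"
    using assms by (simp add: eq)
qed

theorem theorem2:
  fixes P :: "rat poly poly" and k :: rat and p q :: "rat poly" and C :: "(complex \<times> complex) set"
    and d :: nat and a :: "nat \<Rightarrow> int" and b :: int
  defines "C \<equiv> level_curve P k"
  assumes generic: "of_rat k \<notin> bifurcation_set P"
    and irreducible: "irreducible_algebraic_set C"
    and infinite_points: "infinite (integral_points C)"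
    and not_pell: "\<nexists>(\<Phi> :: rat \<times> rat \<Rightarrow> rat \<times> rat) (e :: int) (\<alpha> :: rat) (\<beta> :: rat).
        plane_automorphism \<Phi> \<and> e > 0 \<and> \<not> is_square e \<and> \<alpha> \<noteq> 0 \<and>
        (\<forall>x y. eval2 P (\<Phi> (x, y)) = \<alpha> * (x ^ 2 - of_int e * y ^ 2) + \<beta>)"
    and parametrisation: "polynomial_parametrisation C (map_poly of_rat p) (map_poly of_rat q)"
    and deg: "d = total_degree P" "d = max (degree p) (degree q)" "d = degree p"
    and p_eq: "p = smult (1 / of_int b) (\<Sum>i\<le>d. monom (of_int (a i)) i)"
    and gcd_eq: "Gcd (insert b (a ` {..d})) = 1"
    and a_pos: "a d > 0" and b_pos: "b > 0"
  shows "\<forall>\<epsilon>>0. \<exists>B\<^sub>0\<ge>0. \<forall>B\<ge>B\<^sub>0.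
           real (num_integral_points C B) \<le> 2 * real_of_int (a d) powr (1 - 1 / real d)
                              * real_of_int b powr (1 / real d) * B powr (1 / real d) + 1 + \<epsilon>"
proof (intro allI impI)
  fix \<epsilon> :: real assume "\<epsilon> > 0"
  let ?c = "map_poly (of_rat :: rat \<Rightarrow> complex)" and ?r = "map_poly (of_rat :: rat \<Rightarrow> real)"
  have range: "range (\<lambda>t. (poly (?c p) t, poly (?c q) t)) = C"
    using parametrisation by (simp add: polynomial_parametrisation_def)
  have inj: "inj (\<lambda>t. (poly (?c p) t, poly (?c q) t))"
    using inj_polynomial_parametrisation[OF generic] parametrisation by (simp add: C_def)
  \<comment> \<open>A constant parametrisation would leave only one point on \<open>C\<close>,
    against \<open>infinite_points\<close>.\<close>
  have "d > 0"
  proof (rule ccontr)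
    assume "\<not> d > 0"
    then have "degree p = 0" "degree q = 0" using deg by auto
    then obtain x y where "p = [:x:]" "q = [:y:]" by (metis degree_eq_zeroE)
    then have "C \<subseteq> {(of_rat x, of_rat y)}" using range by (auto simp: map_poly_pCons)
    then show False
      using infinite_points by (metis integral_points_def finite.emptyI finite_insert finite_subset inf.coboundedI1)
  qed
  have coeff_p: "coeff p i = (if i \<le> d then of_int (a i) / of_int b else 0)" for i
    by (subst p_eq) (simp add: coeff_sum coeff_monom)
  have parameter: "\<exists>s::int. z = (of_rat (poly p (of_int s / of_int (a d))), of_rat (poly q (of_int s / of_int (a d))))"
    if z: "z \<in> integral_points C" for z
  proof -
    obtain t where t: "z = (poly (?c p) t, poly (?c q) t)"
      using z range unfolding integral_points_def by blast
    obtain m n :: int where mn: "poly (?c p) t = of_int m" "poly (?c q) t = of_int n"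
      using z t unfolding integral_points_def by (auto elim!: Ints_cases)
    have c_diff: "poly (?c (f + [:- of_int l:])) w = poly (?c f) w - of_int l" for f l w
      by (simp add: map_poly_of_rat_add of_rat_minus map_poly_pCons)
    \<comment> \<open>Injectivity over the complex numbers says that \<open>t\<close> is the only
      common root of the rational polynomials \<open>p - m\<close> and \<open>q - n\<close>.\<close>
    have "t \<in> \<rat>"
    proof (rule rational_if_unique_common_root)
      show "p + [:- of_int m:] \<noteq> 0"
      proof
        assume "p + [:- of_int m:] = 0"
        then have "p = - [:- of_int m:]" by (rule eq_neg_iff_add_eq_0[THEN iffD2])
        then show False using \<open>d > 0\<close> deg(3) by simp
      qed
      show "poly (?c (p + [:- of_int m:])) t = 0" "poly (?c (q + [:- of_int n:])) t = 0"
        using mn by (simp_all only: c_diff) auto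
      show "w = t" if "poly (?c (p + [:- of_int m:])) w = 0" "poly (?c (q + [:- of_int n:])) w = 0" for w
        using that mn by (intro injD[OF inj]) (simp only: c_diff, simp)
    qed
    then obtain \<tau> where \<tau>: "t = of_rat \<tau>" by (auto elim: Rats_cases)
    have "(of_rat (poly p \<tau>) :: complex) = of_rat (of_int m)"
      using mn(1) by (simp add: \<tau> poly_map_poly_of_rat)
    then have "poly p \<tau> = of_int m" by (simp only: of_rat_eq_iff)
    moreover have "poly p \<tau> = (\<Sum>i\<le>d. of_int (a i) * \<tau> ^ i) / of_int b"
      by (simp add: p_eq poly_sum poly_monom)
    \<comment> \<open>Clearing \<open>b\<close> keeps the right side an integer, so the denominator
      of \<open>\<tau>\<close> is controlled by \<open>a d\<close> alone.\<close>
    ultimately have "(\<Sum>i\<le>d. of_int (a i) * \<tau> ^ i) = of_int (b * m)"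
      using b_pos by (simp add: field_simps)
    then have "of_int (a d) * \<tau> \<in> \<int>" by (rule lead_coeff_mult_root_in_Ints[OF \<open>d > 0\<close>])
    then obtain s where "of_int (a d) * \<tau> = of_int s" by (auto elim: Ints_cases)
    then have "\<tau> = of_int s / of_int (a d)" using a_pos by (simp add: field_simps)
    then show ?thesis by (metis t \<tau> poly_map_poly_of_rat)
  qed
  define L where "L = real_of_int (a d) / real_of_int b"
  have "L > 0" using a_pos b_pos by (simp add: L_def)
  have deg_r: "degree (?r p) = d" by (simp add: degree_map_poly_of_rat deg(3))
  have lead_r: "lead_coeff (?r p) = L"
    by (simp add: deg_r coeff_map_poly coeff_p L_def of_rat_divide)
  define \<beta> where "\<beta> = coeff (?r p) (d - 1) / (real d * L)"
  \<comment> \<open>Passing from \<open>t\<close> to \<open>s = a d * t\<close> multiplies the error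
    by \<open>a d\<close>, and the interval has two ends:
    \<open>2 * a d * \<delta> = \<epsilon>\<close>.\<close>
  define \<delta> where "\<delta> = \<epsilon> / (2 * real_of_int (a d))"
  have "\<delta> > 0" using \<open>\<epsilon> > 0\<close> a_pos by (simp add: \<delta>_def)
  obtain B0 where "B0 \<ge> 0" and B0: "\<And>B t. B \<ge> B0 \<Longrightarrow> \<bar>poly (?r p) t\<bar> \<le> B \<Longrightarrow>
      \<bar>t + \<beta>\<bar> \<le> (B / L) powr (1 / real d) + \<delta>"
    using poly_sublevel_radius[of "?r p" \<delta>] \<open>d > 0\<close> \<open>L > 0\<close> \<open>\<delta> > 0\<close>
    unfolding deg_r lead_r[unfolded deg_r] \<beta>_def by blast
  show "\<exists>B\<^sub>0\<ge>0. \<forall>B\<ge>B\<^sub>0.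
           real (num_integral_points C B) \<le> 2 * real_of_int (a d) powr (1 - 1 / real d)
                              * real_of_int b powr (1 / real d) * B powr (1 / real d) + 1 + \<epsilon>"
  proof (intro exI[of _ B0] conjI allI impI)
    fix B assume "B \<ge> B0"
    define \<rho> where "\<rho> = real_of_int (a d) * ((B / L) powr (1 / real d) + \<delta>)"
    define S where "S = {s::int. \<bar>of_int s + of_int (a d) * \<beta>\<bar> \<le> \<rho>}"
    have "\<rho> \<ge> 0" using a_pos \<open>\<delta> > 0\<close> by (simp add: \<rho>_def)
    \<comment> \<open>The bound on \<open>x\<close> already confines the parameter. For an upper
      bound on the count it is enough that \<open>S\<close> covers the points.\<close>
    have "{(x, y) \<in> integral_points C. norm x \<le> B \<and> norm y \<le> B} \<subseteq>
        (\<lambda>s. (of_rat (poly p (of_int s / of_int (a d))), of_rat (poly q (of_int s / of_int (a d))))) ` S"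
    proof clarify
      fix x y assume "(x, y) \<in> integral_points C" and "norm x \<le> B"
      then obtain s :: int where s: "x = of_rat (poly p (of_int s / of_int (a d)))"
          "y = of_rat (poly q (of_int s / of_int (a d)))"
        using parameter by blast
      let ?t = "of_int s / of_int (a d) :: rat"
      have "norm x = \<bar>of_rat (poly p ?t) :: real\<bar>"
        by (cases "poly p ?t") (simp add: s(1) of_rat_rat norm_divide)
      then have "\<bar>poly (?r p) (of_rat ?t)\<bar> \<le> B"
        using \<open>norm x \<le> B\<close> by (simp add: poly_map_poly_of_rat)
      then have le: "\<bar>of_rat ?t + \<beta>\<bar> \<le> (B / L) powr (1 / real d) + \<delta>" by (rule B0[OF \<open>B \<ge> B0\<close>])
      have "of_int s + of_int (a d) * \<beta> = of_int (a d) * (of_rat ?t + \<beta>)"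
        using a_pos by (simp add: of_rat_divide distrib_left)
      then have "\<bar>of_int s + of_int (a d) * \<beta>\<bar> = of_int (a d) * \<bar>of_rat ?t + \<beta>\<bar>"
        using a_pos by (simp add: abs_mult)
      also have "\<dots> \<le> \<rho>" unfolding \<rho>_def using le a_pos by (intro mult_left_mono) auto
      finally have "s \<in> S" by (simp add: S_def)
      then show "(x, y) \<in> (\<lambda>s. (of_rat (poly p (of_int s / of_int (a d))),
          of_rat (poly q (of_int s / of_int (a d))))) ` S"
        using s by blast
    qed
    then have "num_integral_points C B \<le> card S"
      unfolding num_integral_points_def
      using card_int_abs_le(1)[OF \<open>\<rho> \<ge> 0\<close>] by (intro surj_card_le) (simp_all add: S_def)
    then have "real (num_integral_points C B) \<le> 2 * \<rho> + 1"
      using card_int_abs_le(2)[OF \<open>\<rho> \<ge> 0\<close>, of "of_int (a d) * \<beta>"] by (simp add: S_def)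
    \<comment> \<open>The outer factor \<open>a d\<close> combines with the power
      \<open>- 1 / d\<close> of \<open>a d\<close> coming from
      \<open>1 / L = b / a d\<close>.\<close>
    moreover have "\<rho> = real_of_int (a d) powr (1 - 1 / real d)
        * real_of_int b powr (1 / real d) * B powr (1 / real d) + \<epsilon> / 2"
      using a_pos b_pos \<open>B0 \<ge> 0\<close> \<open>B \<ge> B0\<close>
      by (simp add: \<rho>_def L_def \<delta>_def powr_diff powr_divide powr_mult field_simps)
    ultimately show "real (num_integral_points C B) \<le> 2 * real_of_int (a d) powr (1 - 1 / real d)
                              * real_of_int b powr (1 / real d) * B powr (1 / real d) + 1 + \<epsilon>"
      by simp
  qed (fact \<open>B0 \<ge> 0\<close>)
qed

end
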